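(* Let $D$ be a D-graph and let $x,y,z$ be distinct $E$-vertices of $D$. If $\psi_E(x,y,z)$ and $\psi_E(y,x,z)$, then there is a vertex $v$ of $D$ such that $v\rhd[z,x]$, $v\rhd[z,y]$, $v\prec x$ and $v\prec y$.
   Context: A graph is a pair of functions $W,E\colon A\to V$ with $A\cap V=\emptyset$. A vertex $v$ is a $W$-vertex if no edge $a$ has $E(a)=v$, an $E$-vertex if no edge $a$ has $W(a)=v$, and inner if it is neither. An edge $a$ is a $W$-edge if $W(a)$ is a $W$-vertex, an $E$-edge if $E(a)$ is an $E$-vertex. $W$-$E$-functional: for every $W$-edge $a$ and edge $b\ne a$, $W(a)\ne W(b)$, and for every $E$-edge $a$ and $b\ne a$, $E(a)\ne E(b)$. A semipath from $v_0$ to $v_n$ is $v_0a_1v_1\dots a_nv_n$ ($n\ge0$) with $\{W(a_i),E(a_i)\}=\{v_{i-1},v_i\}$ and no repeated vertex; weakly connected: any two distinct vertices joined by a semipath; a cycle is a directed closed walk $v_0a_1\dots a_nv_n$, $n\ge1$, $W(a_i)=v_{i-1}$, $E(a_i)=v_i$, vertices distinct except $v_0=v_n$. A D-graph is a finite, acyclic, $W$-$E$-functional, weakly connected graph with an inner vertex. For vertices $u,v$, $[u,v]$ is the set of semipaths from $u$ to $v$; $[u]_W$ is the set of semipaths from $u$ to some $W$-vertex. Two semipaths intersect if they share a vertex. For distinct $E$-vertices $u,v,w$, $\psi_E(v,u,w)$ means every semipath in $[v,w]$ intersects every semipath in $[u]_W$. $v\rhd[x,z]$ means $v$ occurs in every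 semipath in $[x,z]$. $v\prec x$ means $v\ne x$ and $v$ occurs in every semipath in $[x]_W$. *)

theory Defs
  imports "Graph_Theory.Arc_Walk"
begin

text \<open>
  A pair of functions \<open>W, E : A \<rightarrow> V\<close> is a \<^locale>\<open>wf_digraph\<close> with \<open>V = verts D\<close>,
  \<open>A = arcs D\<close>, \<open>W = tail D\<close> and \<open>E = head D\<close>.  Loops and parallel edges are allowed.
  Disjointness of \<open>A\<close> and \<open>V\<close> is automatic, as vertices and edges inhabit separate types.
\<close>

definition W_vertex :: "('v, 'a) pre_digraph \<Rightarrow> 'v \<Rightarrow> bool" where
  "W_vertex D v \<longleftrightarrow> v \<in> verts D \<and> (\<forall>a \<in> arcs D. head D a \<noteq> v)"

definition E_vertex :: "('v, 'a) pre_digraph \<Rightarrow> 'v \<Rightarrow> bool" where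
  "E_vertex D v \<longleftrightarrow> v \<in> verts D \<and> (\<forall>a \<in> arcs D. tail D a \<noteq> v)"

definition inner_vertex :: "('v, 'a) pre_digraph \<Rightarrow> 'v \<Rightarrow> bool" where
  "inner_vertex D v \<longleftrightarrow> v \<in> verts D \<and> \<not> W_vertex D v \<and> \<not> E_vertex D v"

definition W_edge :: "('v, 'a) pre_digraph \<Rightarrow> 'a \<Rightarrow> bool" where
  "W_edge D a \<longleftrightarrow> a \<in> arcs D \<and> W_vertex D (tail D a)"

definition E_edge :: "('v, 'a) pre_digraph \<Rightarrow> 'a \<Rightarrow> bool" where
  "E_edge D a \<longleftrightarrow> a \<in> arcs D \<and> E_vertex D (head D a)"

definition W_E_functional :: "('v, 'a) pre_digraph \<Rightarrow> bool" where
  "W_E_functional D \<longleftrightarrow>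
     (\<forall>a b. W_edge D a \<and> b \<in> arcs D \<and> b \<noteq> a \<longrightarrow> tail D a \<noteq> tail D b) \<and>
     (\<forall>a b. E_edge D a \<and> b \<in> arcs D \<and> b \<noteq> a \<longrightarrow> head D a \<noteq> head D b)"

text \<open>
  The sequence \<open>v\<^sub>0 a\<^sub>1 v\<^sub>1 \<dots> a\<^sub>n v\<^sub>n\<close> is represented by the pair
  \<open>([v\<^sub>0, \<dots>, v\<^sub>n], [a\<^sub>1, \<dots>, a\<^sub>n])\<close>; note the resulting index shift for the edges.
\<close>

type_synonym ('v, 'a) semipath = "'v list \<times> 'a list"

definition is_semipath :: "('v, 'a) pre_digraph \<Rightarrow> ('v, 'a) semipath \<Rightarrow> bool" where
  "is_semipath D p \<longleftrightarrow> (case p of (vs, es) \<Rightarrow>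
     length vs = Suc (length es) \<and> set vs \<subseteq> verts D \<and> set es \<subseteq> arcs D \<and>
     (\<forall>i < length es. {tail D (es ! i), head D (es ! i)} = {vs ! i, vs ! Suc i}) \<and>
     distinct vs)"

definition sp_verts :: "('v, 'a) semipath \<Rightarrow> 'v set" where
  "sp_verts p = set (fst p)"

definition semipaths :: "('v, 'a) pre_digraph \<Rightarrow> 'v \<Rightarrow> 'v \<Rightarrow> ('v, 'a) semipath set" where
  "semipaths D u v = {p. is_semipath D p \<and> hd (fst p) = u \<and> last (fst p) = v}"

definition semipaths_W :: "('v, 'a) pre_digraph \<Rightarrow> 'v \<Rightarrow> ('v, 'a) semipath set" where
  "semipaths_W D u = {p. \<exists>w. W_vertex D w \<and> p \<in> semipaths D u w}"

definition weakly_connected :: "('v, 'a) pre_digraph \<Rightarrow> bool" where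
  "weakly_connected D \<longleftrightarrow>
     (\<forall>u \<in> verts D. \<forall>v \<in> verts D. u \<noteq> v \<longrightarrow> semipaths D u v \<noteq> {})"

locale D_graph = fin_digraph D for D :: "('v, 'a) pre_digraph" (structure) +
  assumes acyclic: "\<not> (\<exists>p. cycle p)"
    and functional: "W_E_functional D"
    and weakly_connected: "weakly_connected D"
    and ex_inner: "\<exists>v. inner_vertex D v"

definition intersects :: "('v, 'a) semipath \<Rightarrow> ('v, 'a) semipath \<Rightarrow> bool" where
  "intersects p q \<longleftrightarrow> sp_verts p \<inter> sp_verts q \<noteq> {}"

text \<open>Only meant for distinct \<open>E\<close>-vertices \<open>u, v, w\<close>; note the argument order \<open>v, u, w\<close>.\<close>

definition psi_E :: "('v, 'a) pre_digraph \<Rightarrow> 'v \<Rightarrow> 'v \<Rightarrow> 'v \<Rightarrow> bool" where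
  "psi_E D v u w \<longleftrightarrow> (\<forall>p \<in> semipaths D v w. \<forall>q \<in> semipaths_W D u. intersects p q)"

text \<open>\<open>v \<rhd> [x, z]\<close>\<close>

definition on_all_semipaths :: "('v, 'a) pre_digraph \<Rightarrow> 'v \<Rightarrow> 'v \<Rightarrow> 'v \<Rightarrow> bool" where
  "on_all_semipaths D v x z \<longleftrightarrow> (\<forall>p \<in> semipaths D x z. v \<in> sp_verts p)"

text \<open>\<open>v \<prec> x\<close>\<close>

definition prec_W :: "('v, 'a) pre_digraph \<Rightarrow> 'v \<Rightarrow> 'v \<Rightarrow> bool" where
  "prec_W D v x \<longleftrightarrow> v \<noteq> x \<and> (\<forall>p \<in> semipaths_W D x. v \<in> sp_verts p)"

end

theory Submission
  imports Defs
begin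

text \<open>
  Let \<open>B\<close> consist of \<open>z\<close> and all \<open>W\<close>-vertices.  If no vertex separates \<open>{x, y}\<close> from \<open>B\<close>, then
  an augmenting-path argument in the style of Menger gives, for every vertex \<open>t\<close>, two disjoint
  paths starting in \<open>x\<close> and \<open>y\<close>, in some order, of which the first ends in \<open>t\<close> and the second in
  \<open>B\<close>.  For \<open>t = z\<close> the second path must end in a \<open>W\<close>-vertex, which contradicts one of the two
  hypotheses on \<open>\<psi>\<^sub>E\<close>.  Hence a separating vertex exists.  It differs from \<open>x\<close> and \<open>y\<close>, because
  \<open>E\<close>-vertices are leaves: \<open>x\<close> cannot lie inside a semipath from \<open>y\<close> to \<open>z\<close>.
\<close>

section \<open>Walks as vertex lists\<close>

text \<open>Edges are forgotten and vertices may repeat, because the argument compares vertex sets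
  only and splicing can create repetitions.\<close>

definition walk_in :: "('v \<Rightarrow> 'v \<Rightarrow> bool) \<Rightarrow> 'v list \<Rightarrow> bool" where
  "walk_in r p \<longleftrightarrow> p \<noteq> [] \<and> successively r p"

lemma walk_in_prefix: "walk_in r (p @ v # q) \<Longrightarrow> walk_in r (p @ [v])"
  by (auto simp: walk_in_def successively_append_iff)

lemma walk_in_splice:
  "walk_in r (p @ v # q) \<Longrightarrow> walk_in r (p' @ v # q') \<Longrightarrow> walk_in r (p @ v # q')"
  by (auto simp: walk_in_def successively_append_iff)

lemma walk_in_snoc: "walk_in r p \<Longrightarrow> r (last p) v \<Longrightarrow> walk_in r (p @ [v])"
  by (auto simp: walk_in_def successively_append_iff)

lemma hd_append_Cons: "hd (p @ v # q) = hd (p @ v # q')"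
  by (cases p) auto

lemma walk_in_rev:
  assumes "symp r" "walk_in r p"
  shows "walk_in r (rev p)"
proof -
  have "successively (\<lambda>u v. r v u) p = successively r p"
    using assms(1) by (intro successively_cong) (auto dest: sympD)
  then show ?thesis
    using assms(2) by (simp add: walk_in_def)
qed

text \<open>Cutting out the stretch between two occurrences of a vertex shortens a walk and keeps
  its ends.\<close>

lemma walk_in_distinct:
  assumes "walk_in r p"
  shows "\<exists>q. walk_in r q \<and> distinct q \<and> hd q = hd p \<and> last q = last p \<and> set q \<subseteq> set p"
  using assms
proof (induction p rule: length_induct)
  case (1 p)
  show ?case
  proof (cases "distinct p")
    case True
    then show ?thesis using 1 by blast
  next
    case False
    then obtain as bs cs v where p: "p = as @ [v] @ bs @ [v] @ cs"
      using not_distinct_decomp by blast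
    let ?q = "as @ v # cs"
    \<comment> \<open>The same walk is split at an earlier and at a later occurrence of
      \<open>v\<close>, and the outer pieces are spliced.\<close>
    have "walk_in r ?q"
      using walk_in_splice[of r as v "bs @ v # cs" "as @ v # bs" cs] 1(2) p by simp
    moreover have "length ?q < length p" "hd ?q = hd p" "last ?q = last p" "set ?q \<subseteq> set p"
      unfolding p by (auto simp: hd_append)
    ultimately show ?thesis
      using 1(1) by (metis subset_trans)
  qed
qed

section \<open>Augmenting a pair of disjoint walks\<close>

text \<open>Which walk starts in \<open>x\<close> is left open, since an augmentation may exchange
  them.\<close>

definition disjoint_pair :: "('v \<Rightarrow> 'v \<Rightarrow> bool) \<Rightarrow> 'v set \<Rightarrow> 'v \<Rightarrow> 'v \<Rightarrow> 'v \<Rightarrow> 'v list \<Rightarrow> 'v list \<Rightarrow> bool" where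
  "disjoint_pair r B x y t p q \<longleftrightarrow> walk_in r p \<and> walk_in r q \<and> {hd p, hd q} = {x, y} \<and>
     last p = t \<and> last q \<in> B \<and> set p \<inter> set q = {}"

text \<open>If \<open>q\<close> passes through \<open>v\<close>, merely extending \<open>p\<close>
  to \<open>v\<close> would break disjointness. A walk \<open>s\<close> that avoids \<open>v\<close>
  then repairs the pair: beyond its last vertex \<open>u\<close> on \<open>p\<close> or on the part
  of \<open>q\<close> before \<open>v\<close>, it leads to \<open>B\<close> without meeting either
  again.\<close>

lemma disjoint_pair_step:
  assumes pq: "disjoint_pair r B x y t p q" and "r t v"
    and avoid: "\<exists>s. walk_in r s \<and> hd s \<in> {x, y} \<and> last s \<in> B \<and> v \<notin> set s"
  shows "\<exists>p q. disjoint_pair r B x y v p q"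
proof -
  have p: "walk_in r p" and q: "walk_in r q" and hds: "{hd p, hd q} = {x, y}"
    and "last p = t" and disj: "set p \<inter> set q = {}"
    using pq by (auto simp: disjoint_pair_def)
  have pv: "walk_in r (p @ [v])"
    using p \<open>r t v\<close> \<open>last p = t\<close> by (simp add: walk_in_snoc)
  have hd_pv: "hd (p @ [v]) = hd p"
    using p by (simp add: walk_in_def)
  show ?thesis
  proof (cases "v \<in> set q")
    case False
    then have "disjoint_pair r B x y v (p @ [v]) q"
      using pq pv hd_pv by (auto simp: disjoint_pair_def)
    then show ?thesis by blast
  next
    case True
    then obtain q1 q2 where q_eq: "q = q1 @ v # q2" and "v \<notin> set q1"
      by (meson split_list_first)
    obtain s where s: "walk_in r s" "hd s \<in> {x, y}" "last s \<in> B" "v \<notin> set s"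
      using avoid by blast
    have "v \<notin> set p"
      using True disj by blast
    have hd_s: "hd s \<in> set s" and hd_p: "hd p \<in> set p"
      using s(1) p by (auto simp: walk_in_def)
    \<comment> \<open>\<open>s\<close> starts where \<open>p\<close> or \<open>q\<close> does, and
      the start of \<open>q\<close> lies in \<open>q1\<close> unless it is \<open>v\<close>, which
      \<open>s\<close> avoids.\<close>
    have "hd s \<in> set p \<union> set q1"
    proof (cases q1)
      case Nil
      then have "hd s = hd p"
        using s hds q_eq hd_s by auto
      then show ?thesis using hd_p by simp
    next
      case (Cons a l)
      then show ?thesis using hds s(2) hd_p q_eq by (auto simp: doubleton_eq_iff)
    qed
    then obtain s1 u s2 where s_eq: "s = s1 @ u # s2" and u: "u \<in> set p \<union> set q1"
      and s2: "\<forall>w \<in> set s2. w \<notin> set p \<union> set q1"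
      using hd_s split_list_last_prop[of s "\<lambda>w. w \<in> set p \<union> set q1"] by blast
    have last_s: "last (l @ u # s2) \<in> B" for l
      using s(3) s_eq by simp
    from u show ?thesis
    proof
      \<comment> \<open>The walks swap roles: \<open>q\<close> now stops at \<open>v\<close>, and
        \<open>p\<close> turns into \<open>s\<close> at \<open>u\<close>.\<close>
      assume "u \<in> set p"
      then obtain p1 p2 where p_eq: "p = p1 @ u # p2"
        by (meson split_list)
      have "walk_in r (p1 @ u # s2)"
        using p p_eq s(1) s_eq walk_in_splice by metis
      moreover have "walk_in r (q1 @ [v])"
        using q q_eq walk_in_prefix by metis
      moreover have "{hd (q1 @ [v]), hd (p1 @ u # s2)} = {x, y}"
        using hds p_eq q_eq hd_append_Cons by (metis insert_commute)
      moreover have "set (q1 @ [v]) \<inter> set (p1 @ u # s2) = {}"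
        using disj p_eq q_eq s2 s(4) s_eq by auto
      ultimately have "disjoint_pair r B x y v (q1 @ [v]) (p1 @ u # s2)"
        using last_s by (simp add: disjoint_pair_def)
      then show ?thesis by blast
    next
      \<comment> \<open>\<open>q\<close> turns into \<open>s\<close> at \<open>u\<close>, before
        reaching \<open>v\<close>, which frees \<open>v\<close> for \<open>p\<close>.\<close>
      assume "u \<in> set q1"
      then obtain q3 q4 where q1_eq: "q1 = q3 @ u # q4"
        by (meson split_list)
      have "q = q3 @ u # (q4 @ v # q2)"
        using q_eq q1_eq by simp
      then have "walk_in r (q3 @ u # s2)" "hd (q3 @ u # s2) = hd q"
        using q s(1) s_eq walk_in_splice hd_append_Cons by metis+
      moreover have "set (p @ [v]) \<inter> set (q3 @ u # s2) = {}"
        using disj q_eq q1_eq s2 s(4) s_eq \<open>v \<notin> set q1\<close> \<open>v \<notin> set p\<close> by auto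
      ultimately have "disjoint_pair r B x y v (p @ [v]) (q3 @ u # s2)"
        using last_s pv hd_pv hds by (simp add: disjoint_pair_def)
      then show ?thesis by blast
    qed
  qed
qed

text \<open>The induction moves the end of the first walk along \<open>w\<close>; the first walk
  itself need not follow \<open>w\<close>.\<close>

lemma ex_disjoint_pair:
  assumes avoid: "\<And>v. \<exists>s. walk_in r s \<and> hd s \<in> {x, y} \<and> last s \<in> B \<and> v \<notin> set s"
    and "walk_in r w" and "hd w = x"
  shows "\<exists>p q. disjoint_pair r B x y (last w) p q"
  using assms(2,3)
proof (induction w rule: rev_induct)
  case Nil
  then show ?case by (simp add: walk_in_def)
next
  case (snoc t w)
  show ?case
  proof (cases "w = []")
    case True
    then have "t = x" using snoc.prems by simp
    \<comment> \<open>A walk from \<open>{x, y}\<close> that avoids \<open>x\<close> starts in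
      \<open>y\<close> and is disjoint from \<open>[x]\<close>.\<close>
    obtain s where s: "walk_in r s" "hd s \<in> {x, y}" "last s \<in> B" "x \<notin> set s"
      using avoid by blast
    then have "hd s = y"
      by (metis empty_iff hd_in_set insert_iff walk_in_def)
    then have "disjoint_pair r B x y x [x] s"
      using s by (simp add: disjoint_pair_def walk_in_def)
    then show ?thesis using \<open>t = x\<close> by auto
  next
    case False
    then have "walk_in r w" "hd w = x" "r (last w) t"
      using snoc.prems by (auto simp: walk_in_def successively_append_iff)
    then show ?thesis
      using snoc.IH disjoint_pair_step avoid by (metis last_snoc)
  qed
qed

section \<open>Semipaths and walks in the adjacency relation\<close>

definition adj :: "('v, 'a) pre_digraph \<Rightarrow> 'v \<Rightarrow> 'v \<Rightarrow> bool" where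
  "adj D u v \<longleftrightarrow> (\<exists>a \<in> arcs D. {tail D a, head D a} = {u, v})"

lemma symp_adj: "symp (adj D)"
  by (auto simp: symp_def adj_def insert_commute)

lemma semipath_walk_in:
  assumes "is_semipath D p"
  shows "walk_in (adj D) (fst p)"
proof -
  obtain vs es where p: "p = (vs, es)" by fastforce
  have len: "length vs = Suc (length es)" and "set es \<subseteq> arcs D"
    and "\<forall>i < length es. {tail D (es ! i), head D (es ! i)} = {vs ! i, vs ! Suc i}"
    using assms by (auto simp: is_semipath_def p)
  then have "adj D (vs ! i) (vs ! Suc i)" if "Suc i < length vs" for i
    using that unfolding adj_def by (metis Suc_less_SucD nth_mem subsetD)
  then show ?thesis
    using len by (auto simp: p walk_in_def successively_conv_nth)
qed

lemma (in wf_digraph) walk_in_adj_verts: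
  assumes "walk_in (adj G) p" "hd p \<in> verts G"
  shows "set p \<subseteq> verts G"
proof -
  have "adj G u v \<Longrightarrow> v \<in> verts G" for u v
    by (auto simp: adj_def doubleton_eq_iff)
  then have "successively (adj G) p \<Longrightarrow> hd p \<in> verts G \<Longrightarrow> set p \<subseteq> verts G"
    by (induction p rule: induct_list012) auto
  then show ?thesis using assms by (simp add: walk_in_def)
qed

text \<open>Passing to a distinct walk and choosing one edge per step may lose vertices, but the
  inclusion suffices to transfer disjointness.\<close>

lemma (in wf_digraph) walk_in_semipath:
  assumes "walk_in (adj G) p" "hd p \<in> verts G"
  shows "\<exists>s \<in> semipaths G (hd p) (last p). sp_verts s \<subseteq> set p"
proof -
  obtain q where q: "walk_in (adj G) q" "distinct q" "hd q = hd p" "last q = last p" "set q \<subseteq> set p"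
    using walk_in_distinct[OF assms(1)] by blast
  have "\<forall>i. Suc i < length q \<longrightarrow> (\<exists>a. a \<in> arcs G \<and> {tail G a, head G a} = {q ! i, q ! Suc i})"
    using q(1) by (auto simp: walk_in_def successively_conv_nth adj_def)
  then obtain f where f: "\<And>i. Suc i < length q \<Longrightarrow>
      f i \<in> arcs G \<and> {tail G (f i), head G (f i)} = {q ! i, q ! Suc i}"
    by metis
  let ?es = "map f [0..<length q - 1]"
  have "q \<noteq> []"
    using q(1) by (simp add: walk_in_def)
  then have "is_semipath G (q, ?es)"
    using q(2) f walk_in_adj_verts[OF q(1)] assms(2) q(3)
    by (auto simp: is_semipath_def)
  then show ?thesis
    using q by (intro bexI[of _ "(q, ?es)"]) (auto simp: semipaths_def sp_verts_def)
qed

text \<open>In an inner position, \<open>x\<close> would be the head of both neighbouring edges;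
  functionality makes these edges equal, hence also the two neighbours of \<open>x\<close>, against
  distinctness.\<close>

lemma E_vertex_semipath_end:
  assumes functional: "W_E_functional D" and x: "E_vertex D x"
    and p: "is_semipath D p" "x \<in> sp_verts p"
  shows "x = hd (fst p) \<or> x = last (fst p)"
proof (rule ccontr)
  assume not_end: "\<not> ?thesis"
  obtain vs1 vs2 where vs: "fst p = vs1 @ x # vs2"
    using p(2) unfolding sp_verts_def by (meson split_list)
  have "vs1 \<noteq> []" "vs2 \<noteq> []"
    using not_end vs by auto
  then have "adj D (last vs1) x" "adj D x (hd vs2)"
    using semipath_walk_in[OF p(1)] vs
    by (auto simp: walk_in_def successively_append_iff successively_Cons)
  then obtain a b where ab: "a \<in> arcs D" "{tail D a, head D a} = {last vs1, x}"
      "b \<in> arcs D" "{tail D b, head D b} = {x, hd vs2}"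
    by (auto simp: adj_def)
  have "tail D a \<noteq> x" "tail D b \<noteq> x"
    using x ab by (auto simp: E_vertex_def)
  then have "head D a = x" "tail D a = last vs1" "head D b = x" "tail D b = hd vs2"
    using ab by (auto simp: doubleton_eq_iff)
  moreover have "distinct (fst p)"
    using p(1) by (auto simp: is_semipath_def)
  then have "last vs1 \<noteq> hd vs2"
    using vs \<open>vs1 \<noteq> []\<close> \<open>vs2 \<noteq> []\<close>
    by (metis disjoint_iff distinct_append hd_in_set last_in_set list.set_intros(2))
  ultimately show False
    using functional x ab unfolding W_E_functional_def E_edge_def by metis
qed

section \<open>The separating vertex\<close>

theorem theorem3p4p1:
  fixes D :: "('v, 'a) pre_digraph" and x y z :: 'v
  assumes "D_graph D"
    and "E_vertex D x" and "E_vertex D y" and "E_vertex D z"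
    and "x \<noteq> y" and "x \<noteq> z" and "y \<noteq> z"
    and "psi_E D x y z" and "psi_E D y x z"
  shows "\<exists>v \<in> verts D. on_all_semipaths D v z x \<and> on_all_semipaths D v z y
           \<and> prec_W D v x \<and> prec_W D v y"
proof -
  interpret D_graph D by fact
  have verts: "x \<in> verts D" "y \<in> verts D" "z \<in> verts D"
    using assms(2-4) by (auto simp: E_vertex_def)
  define B where "B = insert z {w. W_vertex D w}"
  have "\<exists>v. \<forall>s. walk_in (adj D) s \<and> hd s \<in> {x, y} \<and> last s \<in> B \<longrightarrow> v \<in> set s"
  proof (rule ccontr)
    assume "\<not> ?thesis"
    then have avoid:
      "\<And>v. \<exists>s. walk_in (adj D) s \<and> hd s \<in> {x, y} \<and> last s \<in> B \<and> v \<notin> set s"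
      by blast
    obtain w where "w \<in> semipaths D x z"
      using weakly_connected verts \<open>x \<noteq> z\<close> unfolding weakly_connected_def by blast
    then have "walk_in (adj D) (fst w)" "hd (fst w) = x" "last (fst w) = z"
      by (auto simp: semipaths_def semipath_walk_in)
    then obtain p q where pq: "disjoint_pair (adj D) B x y z p q"
      using ex_disjoint_pair[OF avoid] by blast
    then have p: "walk_in (adj D) p" and q: "walk_in (adj D) q" and hds: "{hd p, hd q} = {x, y}"
      and "last p = z" and "last q \<in> B" and disj: "set p \<inter> set q = {}"
      by (auto simp: disjoint_pair_def)
    have "last q \<noteq> z"
      using p q \<open>last p = z\<close> disj by (metis disjoint_iff last_in_set walk_in_def)
    then have W: "W_vertex D (last q)"
      using \<open>last q \<in> B\<close> by (simp add: B_def)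
    have "hd p \<in> verts D" "hd q \<in> verts D"
      using hds verts by (auto simp: doubleton_eq_iff)
    then obtain p' q' where p': "p' \<in> semipaths D (hd p) z" "sp_verts p' \<subseteq> set p"
      and "q' \<in> semipaths D (hd q) (last q)" and q'_sub: "sp_verts q' \<subseteq> set q"
      using walk_in_semipath[OF p] walk_in_semipath[OF q] \<open>last p = z\<close> by blast
    then have q': "q' \<in> semipaths_W D (hd q)"
      using W by (auto simp: semipaths_W_def)
    have "\<not> intersects p' q'"
      using p'(2) q'_sub disj by (auto simp: intersects_def)
    then have "\<not> psi_E D (hd p) (hd q) z"
      using p'(1) q' by (auto simp: psi_E_def)
    \<comment> \<open>The heads are \<open>x\<close> and \<open>y\<close> in one of the two orders,
      and each order is excluded by one of the hypotheses on \<open>psi_E\<close>.\<close>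
    then show False
      using hds assms(8,9) by (auto simp: doubleton_eq_iff)
  qed
  then obtain v where v: "\<And>s. walk_in (adj D) s \<Longrightarrow> hd s \<in> {x, y} \<Longrightarrow> last s \<in> B \<Longrightarrow> v \<in> set s"
    by blast
  \<comment> \<open>A \<open>W\<close>-vertex as \<open>b\<close> serves for \<open>prec_W\<close>;
    \<open>b = z\<close> serves to show that \<open>v\<close> differs from \<open>x\<close> and
    \<open>y\<close>.\<close>
  have to_B: "v \<in> sp_verts p" if "p \<in> semipaths D u b" "u \<in> {x, y}" "b \<in> B" for p u b
    using that v[of "fst p"] by (auto simp: semipaths_def sp_verts_def semipath_walk_in)
  \<comment> \<open>Separation is known for walks that end in \<open>B\<close>, so semipaths
    starting in \<open>z\<close> are reversed.\<close>
  have from_z: "on_all_semipaths D v z u" if "u \<in> {x, y}" for u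
    unfolding on_all_semipaths_def
  proof
    fix p assume "p \<in> semipaths D z u"
    then have "walk_in (adj D) (fst p)" "hd (fst p) = z" "last (fst p) = u"
      by (auto simp: semipaths_def semipath_walk_in)
    then show "v \<in> sp_verts p"
      using v[of "rev (fst p)"] walk_in_rev[OF symp_adj] that
      by (auto simp: B_def hd_rev last_rev sp_verts_def)
  qed
  \<comment> \<open>\<open>u\<close> and \<open>u'\<close> are \<open>x\<close> and \<open>y\<close>
    in either order. If \<open>v = u\<close>, a semipath from \<open>u'\<close> to \<open>z\<close>
    would have the leaf \<open>u\<close> in its interior.\<close>
  have not_end: "v \<noteq> u" if "E_vertex D u" "u \<noteq> z" "{u, u'} = {x, y}" "u' \<noteq> u" "u' \<noteq> z" for u u'
  proof
    assume "v = u"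
    have u': "u' \<in> {x, y}" using that(3) by blast
    then obtain p where p: "p \<in> semipaths D u' z"
      using weakly_connected verts \<open>u' \<noteq> z\<close> unfolding weakly_connected_def by blast
    then have "u \<in> sp_verts p"
      using to_B u' \<open>v = u\<close> by (auto simp: B_def)
    then have "u = hd (fst p) \<or> u = last (fst p)"
      using E_vertex_semipath_end[OF functional that(1), of p] p unfolding semipaths_def by blast
    then show False
      using p that(2,4) by (auto simp: semipaths_def)
  qed
  \<comment> \<open>\<open>v\<close> was obtained without membership in \<open>verts D\<close>; a
    semipath from \<open>x\<close> to \<open>z\<close> contains it and so provides this.\<close>
  obtain p where p: "p \<in> semipaths D x z"
    using weakly_connected verts \<open>x \<noteq> z\<close> unfolding weakly_connected_def by blast
  then have "v \<in> verts D"
    using to_B[OF p] by (auto simp: B_def semipaths_def is_semipath_def sp_verts_def)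
  moreover have "prec_W D v x" "prec_W D v y"
    using to_B not_end[of x y] not_end[of y x] assms(2-7)
    by (auto simp: prec_W_def semipaths_W_def B_def)
  ultimately show ?thesis
    using from_z by blast
qed

end
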